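(* Let $G$ be a simple connected triangle-free graph with $n\geq 3$ vertices and $m$ edges. Let $d$ and $D$ denote the minimum and maximum vertex degrees of $G$, respectively, where $d\neq D$, and let $a>1$ be real. Then \[KB^a(G)\leq(n-2)^a\left[nd^a+(2m-nd)\left(\frac{D^a-d^a}{D-d}\right)\right],\] with equality if $G$ is a star graph.
   Context: Graphs are finite. The star graph on $n$ vertices is $K_{1,n-1}$. For a simple graph $G$ with vertex set $V(G)$, write $d(u)$ for the degree of a vertex $u$. The degree of an edge $e=uv$ is $d_G(e)=d(u)+d(v)-2$. The edge neighborhood degree $S_e(v)$ of a vertex $v$ is the sum of the degrees $d_G(e)$ of all edges $e$ incident to $v$. For real $a\neq 0,1$, the general Kulli-Basava index is $KB^a(G)=\sum_{v\in V(G)}S_e(v)^a$. *)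

theory Defs
  imports Complex_Main
begin

definition simple_graph :: "'a set \<Rightarrow> 'a set set \<Rightarrow> bool" where
  "simple_graph V E \<longleftrightarrow> finite V \<and> (\<forall>e\<in>E. e \<subseteq> V \<and> card e = 2)"

definition connected_graph :: "'a set \<Rightarrow> 'a set set \<Rightarrow> bool" where
  "connected_graph V E \<longleftrightarrow> V \<noteq> {} \<and> (\<forall>u\<in>V. \<forall>v\<in>V. (u, v) \<in> {(x, y). {x, y} \<in> E}\<^sup>*)"

text \<open>In a simple graph every edge has exactly two elements, so the three edges
  below force the vertices to be pairwise distinct.\<close>

definition triangle_free :: "'a set set \<Rightarrow> bool" where
  "triangle_free E \<longleftrightarrow> \<not> (\<exists>u v w. {u, v} \<in> E \<and> {v, w} \<in> E \<and> {u, w} \<in> E)"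

definition complete_bipartite :: "nat \<Rightarrow> nat \<Rightarrow> 'a set \<Rightarrow> 'a set set \<Rightarrow> bool" where
  "complete_bipartite p q V E \<longleftrightarrow>
     (\<exists>A B. finite A \<and> finite B \<and> card A = p \<and> card B = q \<and> A \<inter> B = {} \<and> V = A \<union> B
        \<and> E = {{x, y} | x y. x \<in> A \<and> y \<in> B})"

definition star_graph :: "'a set \<Rightarrow> 'a set set \<Rightarrow> bool" where
  "star_graph V E \<longleftrightarrow> complete_bipartite 1 (card V - 1) V E"

definition incident_edges :: "'a set set \<Rightarrow> 'a \<Rightarrow> 'a set set" where
  "incident_edges E v = {e \<in> E. v \<in> e}"

definition degree :: "'a set set \<Rightarrow> 'a \<Rightarrow> nat" where
  "degree E v = card (incident_edges E v)"

definition min_degree :: "'a set \<Rightarrow> 'a set set \<Rightarrow> nat" where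
  "min_degree V E = Min (degree E ` V)"

definition max_degree :: "'a set \<Rightarrow> 'a set set \<Rightarrow> nat" where
  "max_degree V E = Max (degree E ` V)"

text \<open>For an edge \<open>e = {u, v}\<close> of a simple graph the sum is \<open>d(u) + d(v)\<close>; both
  endpoints have degree at least 1, so the subtraction does not truncate.\<close>

definition edge_degree :: "'a set set \<Rightarrow> 'a set \<Rightarrow> nat" where
  "edge_degree E e = (\<Sum>u\<in>e. degree E u) - 2"

definition edge_nbhd_degree :: "'a set set \<Rightarrow> 'a \<Rightarrow> nat" where
  "edge_nbhd_degree E v = (\<Sum>e\<in>incident_edges E v. edge_degree E e)"

text \<open>For \<open>a > 0\<close> a vertex with edge neighborhood degree 0 contributes
  \<open>0 powr a = 0\<close>, as usual; for \<open>a < 0\<close> the index is meaningful only when there is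
  no such vertex.\<close>

definition general_kulli_basava :: "real \<Rightarrow> 'a set \<Rightarrow> 'a set set \<Rightarrow> real" where
  "general_kulli_basava a V E = (\<Sum>v\<in>V. real (edge_nbhd_degree E v) powr a)"

end

theory Submission imports Defs "HOL-Analysis.Convex" begin

text \<open>
  Two inequalities combine, one combinatorial and one analytic.

  In a triangle-free graph the endpoints of an edge have disjoint neighbourhoods, so their degrees
  add up to at most \<open>n\<close> and every edge has degree at most \<open>n - 2\<close>. Summing over the edges at \<open>v\<close>
  bounds the edge neighbourhood degree of \<open>v\<close> by \<open>d(v) (n - 2)\<close>, and hence its \<open>a\<close>-th power by
  \<open>(n - 2)\<^sup>a d(v)\<^sup>a\<close>.

  All degrees lie in the interval from \<open>d\<close> to \<open>D\<close>, on which the convex function \<open>x\<^sup>a\<close> stays below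
  its chord. The chord is affine, so its sum over all vertices depends only on \<open>n\<close> and on the
  sum of the degrees, which is \<open>2 m\<close> by the handshake lemma; this sum is the bracket in the bound.

  The first inequality is sharp when every edge has degree exactly \<open>n - 2\<close>, the second when no
  vertex has a degree strictly between \<open>d\<close> and \<open>D\<close>. Both happen in a star: an edge joins the centre,
  of degree \<open>n - 1\<close>, to a leaf, of degree \<open>1\<close>.
\<close>

section \<open>Degrees in simple graphs\<close>

lemma simple_graph_finite_edges:
  assumes "simple_graph V E"
  shows "finite E"
proof (rule finite_subset)
  show "E \<subseteq> Pow V" "finite (Pow V)"
    using assms by (auto simp: simple_graph_def)
qed

text \<open>Degrees count edges, but disjointness is a statement about neighbourhoods, so degrees have to
  be read as sizes of neighbourhoods.\<close>

lemma degree_eq_card_neighbours: "degree E v = card {u. {v, u} \<in> E}"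
  if "simple_graph V E"
proof -
  have edge: "\<exists>u. e = {v, u}" if "e \<in> E" "v \<in> e" for e
  proof -
    have "card e = 2"
      using that \<open>simple_graph V E\<close> by (auto simp: simple_graph_def)
    then show ?thesis
      using that by (auto simp: card_2_iff)
  qed
  have "incident_edges E v = (\<lambda>u. {v, u}) ` {u. {v, u} \<in> E}"
    using edge by (fastforce simp: incident_edges_def)
  moreover have "inj_on (\<lambda>u. {v, u}) {u. {v, u} \<in> E}"
    by (auto simp: inj_on_def doubleton_eq_iff)
  ultimately show ?thesis
    by (simp add: degree_def card_image)
qed

lemma handshake:
  assumes "simple_graph V E"
  shows "(\<Sum>v\<in>V. degree E v) = 2 * card E"
  unfolding degree_def incident_edges_def
proof (rule sum_multicount)
  show "finite V" "finite E"
    using assms simple_graph_finite_edges by (auto simp: simple_graph_def)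
  have "{v \<in> V. v \<in> e} = e" "card e = 2" if "e \<in> E" for e
    using assms that by (auto simp: simple_graph_def)
  then show "\<forall>e\<in>E. card {v \<in> V. v \<in> e} = 2"
    by simp
qed

lemma min_degree_le:
  assumes "finite V" "v \<in> V"
  shows "min_degree V E \<le> degree E v"
  using assms by (simp add: min_degree_def)

lemma le_max_degree:
  assumes "finite V" "v \<in> V"
  shows "degree E v \<le> max_degree V E"
  using assms by (simp add: max_degree_def)

lemma min_degree_attained:
  assumes "finite V" "V \<noteq> {}"
  shows "min_degree V E \<in> degree E ` V"
  using assms by (simp add: min_degree_def)

lemma max_degree_attained:
  assumes "finite V" "V \<noteq> {}"
  shows "max_degree V E \<in> degree E ` V"
  using assms by (simp add: max_degree_def)

text \<open>A path leaving a vertex begins with an edge at that vertex, so connectedness rules out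
  isolated vertices. This places all degrees in the open half-line where the chord bound below
  is stated.\<close>

lemma connected_graph_degree_pos:
  assumes "simple_graph V E" "connected_graph V E" "card V \<ge> 2" "v \<in> V"
  shows "degree E v > 0"
proof -
  have "\<not> V \<subseteq> {v}"
    using assms(3) card_mono[of "{v}" V] by auto
  then obtain u where "u \<in> V" "u \<noteq> v"
    by blast
  then have "(v, u) \<in> {(x, y). {x, y} \<in> E}\<^sup>*"
    using assms(2,4) by (auto simp: connected_graph_def)
  then obtain y where "{v, y} \<in> E"
    using \<open>u \<noteq> v\<close> by (auto elim: converse_rtranclE)
  then have "{v, y} \<in> incident_edges E v"
    by (simp add: incident_edges_def)
  moreover have "finite (incident_edges E v)"
    using simple_graph_finite_edges[OF assms(1)] by (simp add: incident_edges_def)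
  ultimately show ?thesis
    by (auto simp: degree_def card_gt_0_iff)
qed

section \<open>Edge degrees\<close>

text \<open>A common neighbour of the endpoints would close a triangle, so the two neighbourhoods are
  disjoint subsets of the vertex set.\<close>

lemma triangle_free_edge_degree_le:
  assumes "simple_graph V E" "triangle_free E" "e \<in> E"
  shows "edge_degree E e \<le> card V - 2"
proof -
  have "card e = 2"
    using assms(1,3) by (auto simp: simple_graph_def)
  then obtain u v where e: "e = {u, v}" "u \<noteq> v"
    by (auto simp: card_2_iff)
  let ?N = "\<lambda>w. {x. {w, x} \<in> E}"
  have sub: "?N w \<subseteq> V" for w
    using assms(1) by (auto simp: simple_graph_def)
  have fin: "finite V"
    using assms(1) by (simp add: simple_graph_def)
  have disj: "?N u \<inter> ?N v = {}"
    using assms(2,3) e(1) by (auto simp: triangle_free_def)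
  have "degree E u + degree E v = card (?N u \<union> ?N v)"
    using card_Un_disjoint[OF _ _ disj] finite_subset[OF sub fin]
    by (simp add: degree_eq_card_neighbours[OF assms(1)])
  also have "\<dots> \<le> card V"
    using sub fin by (intro card_mono) auto
  finally show ?thesis
    using e by (simp add: edge_degree_def)
qed

lemma edge_nbhd_degree_le:
  assumes "\<And>e. e \<in> E \<Longrightarrow> edge_degree E e \<le> k"
  shows "edge_nbhd_degree E v \<le> degree E v * k"
  unfolding edge_nbhd_degree_def degree_def
  using assms by (intro sum_bounded_above[THEN order_trans]) (auto simp: incident_edges_def)

lemma edge_nbhd_degree_eq:
  assumes "\<And>e. e \<in> E \<Longrightarrow> edge_degree E e = k"
  shows "edge_nbhd_degree E v = degree E v * k"
proof -
  have "edge_nbhd_degree E v = (\<Sum>e\<in>incident_edges E v. k)"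
    unfolding edge_nbhd_degree_def
    using assms by (intro sum.cong) (auto simp: incident_edges_def)
  then show ?thesis
    by (simp add: degree_def)
qed

section \<open>The chord of a power function\<close>

definition powr_chord :: "real \<Rightarrow> real \<Rightarrow> real \<Rightarrow> real \<Rightarrow> real" where
  "powr_chord a p q x = p powr a + (x - p) * ((q powr a - p powr a) / (q - p))"

lemma powr_le_powr_chord:
  assumes "a \<ge> 1" "0 < p" "p \<le> x" "x \<le> q"
  shows "x powr a \<le> powr_chord a p q x"
proof -
  have "convex_on {p..q} (\<lambda>x. x powr a)"
    using assms by (intro convex_on_subset[OF powr_convex]) auto
  then have "x powr a \<le> (q powr a - p powr a) / (q - p) * (x - p) + p powr a"
    by (rule convex_onD_Icc') (use assms in auto)
  then show ?thesis
    by (simp add: powr_chord_def mult.commute add.commute)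
qed

lemma powr_chord_left: "powr_chord a p q p = p powr a"
  by (simp add: powr_chord_def)

lemma powr_chord_right: "p \<noteq> q \<Longrightarrow> powr_chord a p q q = q powr a"
  by (simp add: powr_chord_def)

lemma sum_powr_chord_degree:
  assumes "simple_graph V E"
  shows "(\<Sum>v\<in>V. powr_chord a p q (real (degree E v)))
    = real (card V) * p powr a
      + (2 * real (card E) - real (card V) * p) * ((q powr a - p powr a) / (q - p))"
proof -
  have "(\<Sum>v\<in>V. real (degree E v)) = 2 * real (card E)"
    using arg_cong[OF handshake[OF assms], of real] by simp
  then show ?thesis
    by (simp add: powr_chord_def sum.distrib sum_subtractf flip: sum_distrib_right sum_divide_distrib)
qed

section \<open>Stars\<close>

lemma star_graph_degrees:
  assumes "star_graph V E" "card V \<ge> 2"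
  obtains c where "c \<in> V" "E = {{c, y} | y. y \<in> V - {c}}" "degree E c = card V - 1"
    "\<And>y. y \<in> V - {c} \<Longrightarrow> degree E y = 1"
proof -
  obtain A B where AB: "card A = 1" "card B = card V - 1" "A \<inter> B = {}" "V = A \<union> B"
    "E = {{x, y} | x y. x \<in> A \<and> y \<in> B}"
    using assms(1) by (auto simp: star_graph_def complete_bipartite_def)
  obtain c where c: "A = {c}"
    using AB(1) by (auto simp: card_1_singleton_iff)
  have B: "B = V - {c}" and "c \<in> V"
    using AB c by auto
  have E: "E = {{c, y} | y. y \<in> V - {c}}"
    using AB(5) c B by auto
  have "incident_edges E c = (\<lambda>y. {c, y}) ` B"
    unfolding incident_edges_def E B by auto
  moreover have "inj_on (\<lambda>y. {c, y}) B"
    by (auto simp: inj_on_def doubleton_eq_iff)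
  ultimately have "degree E c = card V - 1"
    using AB(2) by (simp add: degree_def card_image)
  moreover have "degree E y = 1" if "y \<in> V - {c}" for y
  proof -
    have "incident_edges E y = {{c, y}}"
      unfolding incident_edges_def E using that by auto
    then show ?thesis
      by (simp add: degree_def)
  qed
  ultimately show ?thesis
    using that \<open>c \<in> V\<close> E by blast
qed

lemma star_graph_edge_degree:
  assumes "star_graph V E" "card V \<ge> 2" "e \<in> E"
  shows "edge_degree E e = card V - 2"
proof -
  obtain c where c: "E = {{c, y} | y. y \<in> V - {c}}" "degree E c = card V - 1"
    "\<And>y. y \<in> V - {c} \<Longrightarrow> degree E y = 1"
    using star_graph_degrees[OF assms(1,2)] by blast
  obtain y where "e = {c, y}" "y \<in> V - {c}"
    using assms(3) c(1) by blast
  then show ?thesis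
    using c(2,3) assms(2) by (auto simp: edge_degree_def)
qed

text \<open>Only two values occur as degrees in a star, so every degree is extremal as soon as the
  extremal degrees differ.\<close>

lemma star_graph_degree_extremal:
  assumes "star_graph V E" "finite V" "card V \<ge> 2" "min_degree V E \<noteq> max_degree V E" "v \<in> V"
  shows "degree E v = min_degree V E \<or> degree E v = max_degree V E"
proof -
  obtain c where "degree E c = card V - 1" "\<And>y. y \<in> V - {c} \<Longrightarrow> degree E y = 1"
    using star_graph_degrees[OF assms(1,3)] by blast
  then have two: "degree E ` V \<subseteq> {1, card V - 1}"
    by auto
  have "V \<noteq> {}"
    using assms(5) by auto
  then have "min_degree V E \<in> {1, card V - 1}" "max_degree V E \<in> {1, card V - 1}"
    using two min_degree_attained[OF assms(2)] max_degree_attained[OF assms(2)] by blast+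
  moreover have "degree E v \<in> {1, card V - 1}"
    using two assms(5) by blast
  ultimately show ?thesis
    using assms(4) by auto
qed

section \<open>The bound on the general Kulli-Basava index\<close>

theorem corollary3p11:
  fixes V :: "'a set" and E :: "'a set set" and n m d D :: nat and a :: real
  assumes "simple_graph V E"
    and "connected_graph V E"
    and "triangle_free E"
    and "n = card V" and "n \<ge> 3"
    and "m = card E"
    and "d = min_degree V E" and "D = max_degree V E" and "d \<noteq> D"
    and "a > 1"
  shows "general_kulli_basava a V E
           \<le> (real n - 2) powr a *
              (real n * real d powr a
               + (2 * real m - real n * real d)
                 * ((real D powr a - real d powr a) / (real D - real d)))
         \<and> (star_graph V E \<longrightarrow>
           general_kulli_basava a V E
           = (real n - 2) powr a *
              (real n * real d powr a
               + (2 * real m - real n * real d)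
                 * ((real D powr a - real d powr a) / (real D - real d))))"
proof -
  let ?deg = "\<lambda>v. real (degree E v)"
  let ?chord = "powr_chord a (real d) (real D)"
  have fin: "finite V" and ne: "V \<noteq> {}"
    using assms(1,2) by (auto simp: simple_graph_def connected_graph_def)
  have n2: "card V \<ge> 2" and sub2: "real (card V - 2) = real n - 2"
    using assms(4,5) by auto
  have bounds: "d \<le> degree E v" "degree E v \<le> D" if "v \<in> V" for v
    using that fin min_degree_le le_max_degree assms(7,8) by auto
  have "d > 0"
    using connected_graph_degree_pos[OF assms(1,2) n2] min_degree_attained[OF fin ne, of E] assms(7)
    by auto
  have total: "(\<Sum>v\<in>V. (real n - 2) powr a * ?chord (?deg v))
      = (real n - 2) powr a * (real n * real d powr a
        + (2 * real m - real n * real d) * ((real D powr a - real d powr a) / (real D - real d)))"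
    using sum_powr_chord_degree[OF assms(1)] by (simp add: assms(4,6) flip: sum_distrib_left)
  have factor: "real (degree E v * (card V - 2)) powr a = (real n - 2) powr a * ?deg v powr a" for v
    using assms(5) by (simp add: sub2 powr_mult mult.commute)

  have upper: "real (edge_nbhd_degree E v) powr a \<le> (real n - 2) powr a * ?chord (?deg v)"
    if "v \<in> V" for v
  proof -
    have "edge_nbhd_degree E v \<le> degree E v * (card V - 2)"
      using triangle_free_edge_degree_le[OF assms(1,3)] by (rule edge_nbhd_degree_le)
    then have "real (edge_nbhd_degree E v) powr a \<le> real (degree E v * (card V - 2)) powr a"
      using assms(10) by (intro powr_mono2) (auto simp del: of_nat_mult)
    also have "\<dots> = (real n - 2) powr a * ?deg v powr a"
      by (rule factor)
    also have "\<dots> \<le> (real n - 2) powr a * ?chord (?deg v)"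
      using bounds[OF that] \<open>d > 0\<close> assms(10)
      by (intro mult_left_mono powr_le_powr_chord) auto
    finally show ?thesis .
  qed

  have exact: "real (edge_nbhd_degree E v) powr a = (real n - 2) powr a * ?chord (?deg v)"
    if star: "star_graph V E" and "v \<in> V" for v
  proof -
    have "edge_nbhd_degree E v = degree E v * (card V - 2)"
      using star_graph_edge_degree[OF star n2] by (rule edge_nbhd_degree_eq)
    moreover have "degree E v = d \<or> degree E v = D"
      using star_graph_degree_extremal[OF star fin n2 _ \<open>v \<in> V\<close>] assms(7-9) by simp
    then have "?chord (?deg v) = ?deg v powr a"
      using assms(9) by (auto simp: powr_chord_left powr_chord_right)
    ultimately show ?thesis
      using factor by simp
  qed

  show ?thesis
    unfolding general_kulli_basava_def total[symmetric]
    using upper exact by (auto intro!: sum_mono sum.cong)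
qed

end
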